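(* There exist finitely generated torsion-free groups that satisfy a positive generalized identity but are not polycyclic. Additionally, these groups can be chosen to be solvable of arbitrarily large derived length: for every positive integer $d$ there exists a finitely generated, torsion-free, solvable group of derived length at least $d$ which is not polycyclic and which belongs to $\widehat{\mathcal{B}}_n$ for some positive integer $n$.
   Context: For elements $x,y$ of a group, $x^y=y^{-1}xy$. A group $G$ satisfies a positive generalized identity of degree $n$ if there exist fixed elements $x_1,\dots,x_n\in G$ such that $g^{x_1}g^{x_2}\cdots g^{x_n}=1$ for all $g\in G$. The class of all such groups is denoted $\widehat{\mathcal{B}}_n$. *)

theory Defs
  imports "HOL-Algebra.Algebra"
begin

definition finitely_generated_group :: "('a, 'b) monoid_scheme \<Rightarrow> bool" where
  "finitely_generated_group G \<longleftrightarrow>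
     group G \<and> (\<exists>S. finite S \<and> S \<subseteq> carrier G \<and> generate G S = carrier G)"

definition torsion_free_group :: "('a, 'b) monoid_scheme \<Rightarrow> bool" where
  "torsion_free_group G \<longleftrightarrow>
     group G \<and> (\<forall>x\<in>carrier G. \<forall>n::nat. n > 0 \<and> x [^]\<^bsub>G\<^esub> n = \<one>\<^bsub>G\<^esub> \<longrightarrow> x = \<one>\<^bsub>G\<^esub>)"

definition polycyclic_group :: "('a, 'b) monoid_scheme \<Rightarrow> bool" where
  "polycyclic_group G \<longleftrightarrow> group G \<and>
     (\<exists>(m::nat) H. H 0 = carrier G \<and> H m = {\<one>\<^bsub>G\<^esub>} \<and>
        (\<forall>i\<le>m. subgroup (H i) G) \<and>
        (\<forall>i<m. H (Suc i) \<lhd> (G\<lparr>carrier := H i\<rparr>) \<and>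
               cyclic_group ((G\<lparr>carrier := H i\<rparr>) Mod H (Suc i))))"

text \<open>Only meaningful for solvable groups: otherwise no term of the derived series is trivial
  and the value is unspecified.\<close>

definition derived_length :: "('a, 'b) monoid_scheme \<Rightarrow> nat" where
  "derived_length G = (LEAST k. (derived G ^^ k) (carrier G) = {\<one>\<^bsub>G\<^esub>})"

definition conjugate :: "('a, 'b) monoid_scheme \<Rightarrow> 'a \<Rightarrow> 'a \<Rightarrow> 'a" where
  "conjugate G x y = inv\<^bsub>G\<^esub> y \<otimes>\<^bsub>G\<^esub> x \<otimes>\<^bsub>G\<^esub> y"

text \<open>The class \<open>B_hat n\<close>; the list \<open>xs\<close> holds the fixed elements \<open>x\<^sub>1, \<dots>, x\<^sub>n\<close>.
  Every group lies in \<open>B_hat 0\<close>, by the empty product, so a meaningful identity needs \<open>n > 0\<close>.\<close>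

definition B_hat :: "nat \<Rightarrow> ('a, 'b) monoid_scheme set" where
  "B_hat n = {G. group G \<and>
     (\<exists>xs. length xs = n \<and> set xs \<subseteq> carrier G \<and>
        (\<forall>g\<in>carrier G. foldr (\<otimes>\<^bsub>G\<^esub>) (map (conjugate G g) xs) \<one>\<^bsub>G\<^esub> = \<one>\<^bsub>G\<^esub>))}"

end

theory Submission
  imports Defs "HOL-Library.Function_Algebras" "HOL-Library.Countable_Set"
begin

text \<open>Applying one positive word to the value of another gives a positive word again, so the
  existence of a positive identity passes to an extension of \<open>Q\<close> by \<open>N\<close> as soon as some positive
  word with coefficients in the whole group kills \<open>N\<close>. The Hantzsche--Wendt group \<open>W\<close> is torsion-free,
  it satisfies such an identity, and it has a homomorphism \<open>\<chi>\<close> onto \<open>{1, -1}\<close>. Given a group \<open>K\<close>, let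
  \<open>K\<close> act on \<open>\<int>[K]\<close> by translation and \<open>W\<close> through \<open>\<chi>\<close>. An element \<open>w\<close> with \<open>\<chi> w = -1\<close> makes
  \<open>g \<mapsto> g g\<^sup>w\<close> trivial on \<open>\<int>[K]\<close>, so \<open>\<int>[K] \<rtimes> (K \<times> W)\<close> inherits a positive identity. It also
  inherits finite generation, torsion-freeness and solvability from \<open>K\<close>; it is not polycyclic, because
  \<open>\<int>[K]\<close> has infinite rank, and its derived length exceeds that of \<open>K\<close>, because the derived subgroups
  of \<open>K\<close> act faithfully on \<open>\<int>[K]\<close>. Iterate, starting from \<open>K = W\<close>.\<close>

section \<open>Positive generalized words\<close>

abbreviation conjugate_prod :: "('a, 'b) monoid_scheme \<Rightarrow> 'a list \<Rightarrow> 'a \<Rightarrow> 'a" where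
  "conjugate_prod G xs g \<equiv> foldr (\<otimes>\<^bsub>G\<^esub>) (map (conjugate G g) xs) \<one>\<^bsub>G\<^esub>"

context group
begin

lemma conjugate_closed [simp]:
  assumes "g \<in> carrier G" "x \<in> carrier G"
  shows "conjugate G g x \<in> carrier G"
  using assms by (simp add: conjugate_def)

lemma conjugate_conjugate:
  assumes "g \<in> carrier G" "x \<in> carrier G" "y \<in> carrier G"
  shows "conjugate G (conjugate G g x) y = conjugate G g (x \<otimes> y)"
  using assms by (simp add: conjugate_def m_assoc inv_mult_group)

lemma conjugate_mult:
  assumes "g \<in> carrier G" "h \<in> carrier G" "y \<in> carrier G"
  shows "conjugate G (g \<otimes> h) y = conjugate G g y \<otimes> conjugate G h y"
proof -
  have "y \<otimes> (inv y \<otimes> (h \<otimes> y)) = h \<otimes> y"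
    using assms by (simp add: m_assoc [symmetric])
  then show ?thesis
    using assms by (simp add: conjugate_def m_assoc)
qed

lemma conjugate_one [simp]: "y \<in> carrier G \<Longrightarrow> conjugate G \<one> y = \<one>"
  by (simp add: conjugate_def)

lemma conjugate_prod_closed [simp]:
  assumes "g \<in> carrier G" "set xs \<subseteq> carrier G"
  shows "conjugate_prod G xs g \<in> carrier G"
  using assms(2) by (induction xs) (simp_all add: assms(1))

lemma conjugate_prod_append:
  assumes "g \<in> carrier G" "set xs \<subseteq> carrier G" "set ys \<subseteq> carrier G"
  shows "conjugate_prod G (xs @ ys) g = conjugate_prod G xs g \<otimes> conjugate_prod G ys g"
  using assms(2)
proof (induction xs)
  case (Cons x xs)
  then show ?case
    using assms conjugate_prod_closed[OF assms(1,3)] conjugate_prod_closed[OF assms(1), of xs]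
    by (simp add: m_assoc del: foldr_append map_append)
qed (use assms conjugate_prod_closed[OF assms(1,3)] in simp)

lemma conjugate_conjugate_prod:
  assumes "g \<in> carrier G" "set xs \<subseteq> carrier G" "y \<in> carrier G"
  shows "conjugate G (conjugate_prod G xs g) y = conjugate_prod G (map (\<lambda>x. x \<otimes> y) xs) g"
  using assms(2)
proof (induction xs)
  case (Cons x xs)
  then show ?case
    using assms conjugate_prod_closed[OF assms(1), of xs]
    by (simp add: conjugate_mult conjugate_conjugate)
qed (use assms in simp)

text \<open>Conjugation by y distributes over the inner product and turns each coefficient x into
  \<open>x \<otimes> y\<close>. So positive words compose, and their lengths multiply.\<close>

lemma conjugate_prod_conjugate_prod:
  assumes "g \<in> carrier G" "set xs \<subseteq> carrier G" "set ys \<subseteq> carrier G"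
  shows "conjugate_prod G ys (conjugate_prod G xs g)
    = conjugate_prod G (concat (map (\<lambda>y. map (\<lambda>x. x \<otimes> y) xs) ys)) g"
  using assms(3)
proof (induction ys)
  case (Cons y ys)
  have "set (map (\<lambda>x. x \<otimes> y) xs) \<subseteq> carrier G"
    "set (concat (map (\<lambda>y. map (\<lambda>x. x \<otimes> y) xs) ys)) \<subseteq> carrier G"
    using assms Cons.prems by auto
  from conjugate_prod_append[OF assms(1) this] show ?case
    using Cons conjugate_conjugate_prod[OF assms(1,2), of y] by simp
qed simp

end

lemma (in group_hom) hom_conjugate_prod:
  assumes "g \<in> carrier G" "set xs \<subseteq> carrier G"
  shows "h (conjugate_prod G xs g) = conjugate_prod H (map h xs) (h g)"
  using assms(2)
proof (induction xs)
  case (Cons x xs)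
  then have "h (conjugate G g x) = conjugate H (h g) (h x)"
    using assms(1) by (simp add: conjugate_def)
  then show ?case
    using Cons assms(1) G.conjugate_prod_closed[OF assms(1), of xs] by simp
qed simp

section \<open>Extensions\<close>

context group_hom
begin

text \<open>Every g agrees with some generated x modulo the kernel, and the quotient
  \<open>inv x \<otimes> g\<close> is generated by assumption.\<close>

lemma generate_eq_carrier_extension:
  assumes "S \<subseteq> carrier G" "generate H (h ` S) = carrier H" "kernel G H h \<subseteq> generate G S"
  shows "generate G S = carrier G"
proof
  show "generate G S \<subseteq> carrier G"
    by (rule G.generate_incl) fact
  show "carrier G \<subseteq> generate G S"
  proof
    fix g assume g: "g \<in> carrier G"
    then have "h g \<in> h ` generate G S"
      using generate_img[OF assms(1)] assms(2) by auto
    then obtain x where x: "x \<in> generate G S" "h x = h g" by auto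
    then have xc: "x \<in> carrier G" using G.generate_in_carrier[OF assms(1)] by blast
    have "inv x \<otimes> g \<in> kernel G H h"
      using x xc g by (simp add: kernel_def)
    then have "x \<otimes> (inv x \<otimes> g) \<in> generate G S"
      using assms(3) x(1) by (blast intro: generate.eng)
    then show "g \<in> generate G S"
      using xc g by (simp add: G.m_assoc [symmetric])
  qed
qed

text \<open>A torsion element dies in a torsion-free image. For direct products this is applied to
  both projections, which together leave only the identity.\<close>

lemma hom_nat_pow_kernel:
  assumes "torsion_free_group H" "x \<in> carrier G" "n > 0" "x [^] (n::nat) = \<one>"
  shows "x \<in> kernel G H h"
proof -
  have "h x [^]\<^bsub>H\<^esub> n = \<one>\<^bsub>H\<^esub>"
    using assms by (metis hom_nat_pow hom_one)
  then show ?thesis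
    using assms by (auto simp: torsion_free_group_def kernel_def)
qed

lemma torsion_free_extension:
  assumes "torsion_free_group H"
    and "\<And>x n. x \<in> kernel G H h \<Longrightarrow> n > 0 \<Longrightarrow> x [^] (n::nat) = \<one> \<Longrightarrow> x = \<one>"
  shows "torsion_free_group G"
  using assms hom_nat_pow_kernel G.is_group unfolding torsion_free_group_def by blast

lemma solvable_extension:
  assumes "h ` carrier G = carrier H" "solvable H" "solvable_seq G (kernel G H h)"
  shows "solvable G"
proof -
  let ?N = "G\<lparr>carrier := kernel G H h\<rparr>"
  interpret N: group ?N
    by (rule subgroup.subgroup_is_group[OF subgroup_kernel G.is_group])
  \<comment> \<open>\<open>solvable_condition\<close> takes the kernel as a group in its own right;
    the inclusion \<open>id\<close> identifies its derived series with the one computed inside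
    G.\<close>
  have hom: "group_hom ?N G id"
    by unfold_locales (auto simp: hom_def kernel_def)
  have "solvable ?N"
  proof -
    obtain n where n: "(derived G ^^ n) (kernel G H h) = {\<one>}"
      using G.solvable_imp_trivial_derived_seq[OF assms(3)] by blast
    have "id ` ((derived ?N ^^ n) (carrier ?N)) = (derived G ^^ n) (id ` carrier ?N)"
      using group_hom.exp_of_derived_img[OF hom, of "carrier ?N" n] by simp
    then show ?thesis
      using N.solvable_iff_trivial_derived_seq n by auto
  qed
  then show ?thesis
    using solvable_condition[OF hom group_hom_axioms assms(1)] assms(2) by simp
qed

text \<open>Coefficients of the identity of H lift to G, and the lifted word takes values in the
  kernel. The word with coefficients \<open>ys\<close>, which may lie anywhere in G, then sends
  these values to the identity.\<close>

lemma B_hat_extension: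
  assumes surj: "h ` carrier G = carrier H" and "H \<in> B_hat n"
    and ys: "set ys \<subseteq> carrier G" "\<And>x. x \<in> kernel G H h \<Longrightarrow> conjugate_prod G ys x = \<one>"
  shows "G \<in> B_hat (n * length ys)"
proof -
  from \<open>H \<in> B_hat n\<close> obtain zs where zs: "length zs = n" "set zs \<subseteq> carrier H"
      "\<And>g. g \<in> carrier H \<Longrightarrow> conjugate_prod H zs g = \<one>\<^bsub>H\<^esub>"
    unfolding B_hat_def by blast
  obtain xs where xs: "zs = map h xs" "set xs \<subseteq> carrier G"
  proof
    show "zs = map h (map (inv_into (carrier G) h) zs)"
      using zs(2) surj by (auto simp: f_inv_into_f subset_iff intro!: map_idI [symmetric])
    show "set (map (inv_into (carrier G) h) zs) \<subseteq> carrier G"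
      using zs(2) surj by (auto intro!: inv_into_into)
  qed
  let ?ws = "concat (map (\<lambda>y. map (\<lambda>x. x \<otimes> y) xs) ys)"
  have "length ?ws = n * length ys"
    using zs(1) xs(1) by (induction ys) auto
  moreover have "set ?ws \<subseteq> carrier G"
    using xs(2) ys(1) by auto
  moreover have "conjugate_prod G ?ws g = \<one>" if g: "g \<in> carrier G" for g
  proof -
    have "conjugate_prod G xs g \<in> kernel G H h"
      using hom_conjugate_prod[OF g xs(2)] zs(3)[of "h g"] xs g by (simp add: kernel_def)
    then show ?thesis
      using G.conjugate_prod_conjugate_prod[OF g xs(2) ys(1)] ys(2) by simp
  qed
  ultimately show ?thesis
    unfolding B_hat_def using G.is_group by blast
qed

end

section \<open>Subgroups of polycyclic groups\<close>

text \<open>Stated relative to an ambient group, so that the ambient group can shrink along a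
  subnormal series while S stays the same.\<close>

definition finitely_generated_subset :: "('a, 'b) monoid_scheme \<Rightarrow> 'a set \<Rightarrow> bool" where
  "finitely_generated_subset G S \<longleftrightarrow> (\<exists>F. finite F \<and> F \<subseteq> S \<and> generate G F = S)"

text \<open>The least positive element divides all others, because remainders stay in J. Without a
  positive element J is zero and d = 0.\<close>

lemma int_subgroup_principal:
  fixes J :: "int set"
  assumes "0 \<in> J" "\<And>a b. a \<in> J \<Longrightarrow> b \<in> J \<Longrightarrow> a - b \<in> J"
  obtains d where "d \<in> J" "\<And>a. a \<in> J \<Longrightarrow> d dvd a"
proof (cases "\<exists>n. n > 0 \<and> int n \<in> J")
  case False
  have "a = 0" if "a \<in> J" for a
  proof (rule ccontr)
    assume "a \<noteq> 0"
    moreover have "- a \<in> J" using assms(2)[OF assms(1) that] by simp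
    ultimately have "\<exists>b\<in>J. b > 0" using that by (cases "a > 0") (auto intro: bexI[of _ "- a"])
    then show False using False by (metis pos_int_cases)
  qed
  then show ?thesis using assms(1) that by force
next
  case True
  define n where "n = (LEAST n. n > 0 \<and> int n \<in> J)"
  have n: "n > 0" "int n \<in> J" using LeastI_ex[OF True] by (auto simp: n_def)
  have neg: "- a \<in> J" if "a \<in> J" for a using assms(2)[OF assms(1) that] by simp
  have add: "a + b \<in> J" if "a \<in> J" "b \<in> J" for a b
    using assms(2)[OF that(1) neg[OF that(2)]] by simp
  have nat_mult: "int n * int k \<in> J" for k
    by (induction k) (use n assms(1) add in \<open>auto simp: algebra_simps\<close>)
  have mult: "int n * k \<in> J" for k
    by (cases k rule: int_cases2) (use nat_mult neg[OF nat_mult] in auto)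
  have "int n dvd a" if "a \<in> J" for a
  proof (rule ccontr)
    assume nd: "\<not> int n dvd a"
    have "a mod int n = a - int n * (a div int n)" by (simp add: minus_mult_div_eq_mod)
    then have "a mod int n \<in> J" using assms(2)[OF that mult] by simp
    moreover have "0 < a mod int n" "a mod int n < int n"
      using nd n(1) pos_mod_sign[of "int n" a] by (auto simp: dvd_eq_mod_eq_0)
    ultimately have "nat (a mod int n) > 0 \<and> int (nat (a mod int n)) \<in> J" "nat (a mod int n) < n"
      by auto
    then show False unfolding n_def using not_less_Least by blast
  qed
  then show ?thesis using n that by blast
qed

text \<open>The image of S in the cyclic group H is again cyclic, so one preimage s of a generator
  of that image, added to generators of the kernel part, suffices.\<close>

lemma (in group_hom) finitely_generated_of_kernel_inter:
  assumes cyc: "cyclic_group H" and S: "subgroup S G"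
    and fg: "finitely_generated_subset G (S \<inter> kernel G H h)"
  shows "finitely_generated_subset G S"
proof -
  obtain c where c: "c \<in> carrier H" "carrier H = range (\<lambda>n::int. c [^]\<^bsub>H\<^esub> n)"
    using cyc H.cyclic_group by blast
  obtain F where F: "finite F" "F \<subseteq> S \<inter> kernel G H h" "generate G F = S \<inter> kernel G H h"
    using fg unfolding finitely_generated_subset_def by blast
  have SG: "x \<in> carrier G" if "x \<in> S" for x
    using that S subgroup.mem_carrier by fast
  \<comment> \<open>All exponents of c that occur in the image of S. If c has finite order, one
    element contributes many exponents, but J is still closed under differences.\<close>
  define J where "J = {k::int. \<exists>x\<in>S. h x = c [^]\<^bsub>H\<^esub> k}"
  have "0 \<in> J"
    unfolding J_def using subgroup.one_closed[OF S] by (force intro: bexI[of _ "\<one>"])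
  moreover have "a - b \<in> J" if "a \<in> J" "b \<in> J" for a b
  proof -
    from that obtain x y where xy: "x \<in> S" "h x = c [^]\<^bsub>H\<^esub> a" "y \<in> S" "h y = c [^]\<^bsub>H\<^esub> b"
      unfolding J_def by blast
    then have "h (x \<otimes> inv y) = c [^]\<^bsub>H\<^esub> (a - b)"
      using SG c(1) by (simp add: H.int_pow_diff)
    moreover have "x \<otimes> inv y \<in> S"
      using xy S by (simp add: subgroup.m_closed subgroup.m_inv_closed)
    ultimately show ?thesis unfolding J_def by blast
  qed
  ultimately obtain d where d: "d \<in> J" "\<And>a. a \<in> J \<Longrightarrow> d dvd a"
    using int_subgroup_principal by blast
  then obtain s where s: "s \<in> S" "h s = c [^]\<^bsub>H\<^esub> d" unfolding J_def by blast
  have sub: "insert s F \<subseteq> S" using F s by blast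
  then have subG: "insert s F \<subseteq> carrier G" using SG by blast
  have "S \<subseteq> generate G (insert s F)"
  proof
    fix x assume x: "x \<in> S"
    then obtain k :: int where k: "h x = c [^]\<^bsub>H\<^esub> k" using c(2) SG hom_closed by blast
    then obtain q where q: "k = d * q" using d(2) x unfolding J_def by blast
    have sq: "s [^] q \<in> generate G (insert s F)"
      using G.subgroup_int_pow_closed[OF G.generate_is_subgroup[OF subG]] by (simp add: generate.incl)
    have sqS: "s [^] q \<in> S" using G.subgroup_int_pow_closed[OF S s(1)] .
    have "h (s [^] q) = h x"
      using k q s SG c(1) by (simp add: hom_int_pow H.int_pow_pow)
    then have "x \<otimes> inv (s [^] q) \<in> S \<inter> kernel G H h"
      using x sqS S SG by (auto simp: kernel_def subgroup.m_closed subgroup.m_inv_closed)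
    then have "x \<otimes> inv (s [^] q) \<in> generate G (insert s F)"
      using F(3) G.mono_generate[of F "insert s F"] by blast
    then have "x \<otimes> inv (s [^] q) \<otimes> s [^] q \<in> generate G (insert s F)"
      using sq by (rule generate.eng)
    then show "x \<in> generate G (insert s F)"
      using x sqS SG by (simp add: G.m_assoc)
  qed
  moreover have "generate G (insert s F) \<subseteq> S"
    by (rule G.generate_subgroup_incl[OF sub S])
  ultimately show ?thesis
    unfolding finitely_generated_subset_def using F(1) sub by (intro exI[of _ "insert s F"]) auto
qed

lemma finitely_generated_subset_consistent:
  assumes "group G" "subgroup H G" "S \<subseteq> H"
  shows "finitely_generated_subset (G\<lparr>carrier := H\<rparr>) S \<longleftrightarrow> finitely_generated_subset G S"
  using group.generate_consistent[OF assms(1) _ assms(2)] assms(3)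
  unfolding finitely_generated_subset_def by (metis order.trans)

lemma polycyclic_imp_finitely_generated_subset:
  assumes "polycyclic_group G" "subgroup S G"
  shows "finitely_generated_subset G S"
proof -
  from assms(1) interpret group G by (simp add: polycyclic_group_def)
  from assms(1) obtain m H where H: "H 0 = carrier G" "H m = {\<one>\<^bsub>G\<^esub>}"
    "\<And>i. i \<le> m \<Longrightarrow> subgroup (H i) G"
    "\<And>i. i < m \<Longrightarrow> H (Suc i) \<lhd> G\<lparr>carrier := H i\<rparr>"
    "\<And>i. i < m \<Longrightarrow> cyclic_group ((G\<lparr>carrier := H i\<rparr>) Mod H (Suc i))"
    unfolding polycyclic_group_def by blast
  \<comment> \<open>Induction downward from the trivial end of the series, for all subgroups S at
    once: the hypothesis is applied to the intersection of S with \<open>H (Suc i)\<close>.\<close>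
  have "i \<le> m \<Longrightarrow> subgroup S G \<Longrightarrow> S \<subseteq> H i \<Longrightarrow> finitely_generated_subset G S" for i S
  proof (induction i arbitrary: S rule: inc_induct)
    case base
    then have "S = {\<one>\<^bsub>G\<^esub>}" using H(2) subgroup.one_closed by blast
    then show ?case
      unfolding finitely_generated_subset_def using generate_one by (intro exI[of _ "{\<one>\<^bsub>G\<^esub>}"]) simp
  next
    case (step i)
    let ?G = "G\<lparr>carrier := H i\<rparr>"
    have sub: "subgroup (H i) G" "subgroup (H (Suc i)) G" using H(3) step.hyps by auto
    interpret N: normal "H (Suc i)" ?G using H(4) step.hyps by blast
    have hom: "group_hom ?G (?G Mod H (Suc i)) (\<lambda>a. H (Suc i) #>\<^bsub>?G\<^esub> a)"
      by (intro group_hom.intro group_hom_axioms.intro N.is_group N.factorgroup_is_group N.r_coset_hom_Mod)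
    have S: "subgroup S ?G" using subgroup_incl[OF step.prems(1) sub(1) step.prems(2)] .
    have ker: "kernel ?G (?G Mod H (Suc i)) (\<lambda>a. H (Suc i) #>\<^bsub>?G\<^esub> a) = H (Suc i)"
    proof
      show "kernel ?G (?G Mod H (Suc i)) (\<lambda>a. H (Suc i) #>\<^bsub>?G\<^esub> a) \<subseteq> H (Suc i)"
        using N.rcos_self[OF _ N.subgroup_axioms] by (auto simp: kernel_def FactGroup_def)
      show "H (Suc i) \<subseteq> kernel ?G (?G Mod H (Suc i)) (\<lambda>a. H (Suc i) #>\<^bsub>?G\<^esub> a)"
        using N.subset N.rcos_const[OF N.is_group] unfolding kernel_def FactGroup_def by auto
    qed
    have "finitely_generated_subset G (S \<inter> H (Suc i))"
      using step.IH subgroups_Inter_pair[OF step.prems(1) sub(2)] by simp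
    \<comment> \<open>The quotient map onto the cyclic factor is defined only on \<open>H i\<close>,
      so the ambient group changes to \<open>?G\<close> and back.\<close>
    then have "finitely_generated_subset ?G (S \<inter> H (Suc i))"
      using finitely_generated_subset_consistent[OF is_group sub(1)] step.prems by blast
    then have "finitely_generated_subset ?G S"
      using group_hom.finitely_generated_of_kernel_inter[OF hom _ S] H(5)[OF step.hyps(2)] ker by simp
    then show ?case
      using finitely_generated_subset_consistent[OF is_group sub(1)] step.prems by blast
  qed
  from this[of 0] show ?thesis
    using assms(2) H(1) subgroup.subset by blast
qed

section \<open>Semidirect products with abelian kernel\<close>

text \<open>The kernel is a subset of an additive type, so that finitely supported functions with
  pointwise addition fit without a separate group structure.\<close>

definition semidirect ::
  "('m::ab_group_add) set \<Rightarrow> ('b, 'c) monoid_scheme \<Rightarrow> ('b \<Rightarrow> 'm \<Rightarrow> 'm) \<Rightarrow> ('m \<times> 'b) monoid" where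
  "semidirect M H \<rho> = \<lparr>carrier = M \<times> carrier H,
     monoid.mult = (\<lambda>(m, h) (n, k). (m + \<rho> h n, h \<otimes>\<^bsub>H\<^esub> k)), one = (0, \<one>\<^bsub>H\<^esub>)\<rparr>"

text \<open>The laws are required on M only: the translation action used later sets values outside
  the carrier to 0, so its identity law fails for arbitrary functions.\<close>

locale module_action = group H for H (structure) +
  fixes M :: "('m::ab_group_add) set" and \<rho> :: "'a \<Rightarrow> 'm \<Rightarrow> 'm"
  assumes zero_closed [simp]: "0 \<in> M"
    and add_closed [simp]: "m \<in> M \<Longrightarrow> n \<in> M \<Longrightarrow> m + n \<in> M"
    and uminus_closed [simp]: "m \<in> M \<Longrightarrow> - m \<in> M"
    and act_closed [simp]: "h \<in> carrier H \<Longrightarrow> m \<in> M \<Longrightarrow> \<rho> h m \<in> M"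
    and act_add: "h \<in> carrier H \<Longrightarrow> m \<in> M \<Longrightarrow> n \<in> M \<Longrightarrow> \<rho> h (m + n) = \<rho> h m + \<rho> h n"
    and act_one [simp]: "m \<in> M \<Longrightarrow> \<rho> \<one> m = m"
    and act_mult: "h \<in> carrier H \<Longrightarrow> k \<in> carrier H \<Longrightarrow> m \<in> M \<Longrightarrow> \<rho> (h \<otimes> k) m = \<rho> h (\<rho> k m)"
begin

abbreviation "P \<equiv> semidirect M H \<rho>"

lemma carrier_P [simp]: "carrier P = M \<times> carrier H"
  by (simp add: semidirect_def)

lemma one_P [simp]: "\<one>\<^bsub>P\<^esub> = (0, \<one>)"
  by (simp add: semidirect_def)

lemma mult_P [simp]: "(m, h) \<otimes>\<^bsub>P\<^esub> (n, k) = (m + \<rho> h n, h \<otimes> k)"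
  by (simp add: semidirect_def)

lemma act_zero [simp]:
  assumes "h \<in> carrier H"
  shows "\<rho> h 0 = 0"
  using act_add[OF assms, of 0 0] by simp

lemma act_uminus:
  assumes "h \<in> carrier H" "m \<in> M"
  shows "\<rho> h (- m) = - \<rho> h m"
  using act_add[OF assms(1) assms(2) uminus_closed[OF assms(2)]] assms
  by (simp add: eq_neg_iff_add_eq_0 add.commute)

lemma act_diff:
  assumes "h \<in> carrier H" "m \<in> M" "n \<in> M"
  shows "\<rho> h (m - n) = \<rho> h m - \<rho> h n"
  using act_add[of h m "- n"] act_uminus[of h n] assms by simp

lemma group_P: "group P"
proof (rule groupI)
  fix x assume "x \<in> carrier P"
  then obtain m h where x: "x = (m, h)" "m \<in> M" "h \<in> carrier H" by auto
  have "\<rho> (inv h) (- m) + \<rho> (inv h) m = 0"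
    using x by (simp add: act_uminus)
  then show "\<exists>y\<in>carrier P. y \<otimes>\<^bsub>P\<^esub> x = \<one>\<^bsub>P\<^esub>"
    using x by (intro bexI[of _ "(\<rho> (inv h) (- m), inv h)"]) auto
qed (auto simp: m_assoc act_add act_mult add.assoc)

sublocale P: group P
  by (rule group_P)

lemma inv_P_fiber [simp]:
  assumes "m \<in> M"
  shows "inv\<^bsub>P\<^esub> (m, \<one>) = (- m, \<one>)"
  using assms by (intro P.inv_equality) auto

lemma inv_P_complement [simp]:
  assumes "h \<in> carrier H"
  shows "inv\<^bsub>P\<^esub> (0, h) = (0, inv h)"
  using assms by (intro P.inv_equality) auto

sublocale proj: group_hom P H snd
  by unfold_locales (auto simp: hom_def)

lemma kernel_proj: "kernel P H snd = M \<times> {\<one>}"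
  by (auto simp: kernel_def)

lemma proj_surj: "snd ` carrier P = carrier H"
  by (simp add: image_iff snd_image_times) (use zero_closed in blast)

lemma pow_P_fiber:
  assumes "m \<in> M"
  shows "(m, \<one>) [^]\<^bsub>P\<^esub> (n::nat) = (\<Sum>i<n. m, \<one>)"
  using assms by (induction n) (auto simp: add.commute)

lemma torsion_free_P:
  assumes "torsion_free_group H" "\<And>m n. m \<in> M \<Longrightarrow> n > 0 \<Longrightarrow> (\<Sum>i<(n::nat). m) = 0 \<Longrightarrow> m = 0"
  shows "torsion_free_group P"
  by (rule proj.torsion_free_extension[OF assms(1)])
    (use assms(2) in \<open>auto simp: kernel_proj pow_P_fiber\<close>)

lemma solvable_P:
  assumes "solvable H"
  shows "solvable P"
proof (rule proj.solvable_extension[OF proj_surj assms])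
  have sub: "subgroup (M \<times> {\<one>}) P"
    using proj.subgroup_kernel by (simp add: kernel_proj)
  have "derived P (M \<times> {\<one>}) \<subseteq> {\<one>\<^bsub>P\<^esub>}"
    unfolding derived_def
  proof (rule P.generate_subgroup_incl[OF _ P.triv_subgroup])
    show "derived_set P (M \<times> {\<one>}) \<subseteq> {\<one>\<^bsub>P\<^esub>}"
      by auto
  qed
  moreover have "\<one>\<^bsub>P\<^esub> \<in> derived P (M \<times> {\<one>})"
    by (simp add: derived_def generate.one del: one_P)
  ultimately have "(derived P ^^ 1) (M \<times> {\<one>}) = {\<one>\<^bsub>P\<^esub>}"
    by (auto simp del: one_P)
  then show "solvable_seq P (kernel P H snd)"
    using P.trivial_derived_seq_imp_solvable[OF sub] by (simp only: kernel_proj)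
qed

text \<open>As \<open>conjugate\<close> is \<open>inv y \<otimes> x \<otimes> y\<close>, the element
  \<open>(0, y)\<close> acts on the fiber through \<open>\<rho> (inv y)\<close>. A positive word
  thus becomes a sum of operators on M, and killing M is a statement about the module alone.\<close>

lemma conjugate_prod_P_fiber:
  assumes "m \<in> M" "set ys \<subseteq> carrier H"
  shows "conjugate_prod P (map (Pair 0) ys) (m, \<one>) = (\<Sum>y\<leftarrow>ys. \<rho> (inv y) m, \<one>)"
  using assms(2)
proof (induction ys)
  case (Cons y ys)
  have "(\<Sum>y\<leftarrow>ys. \<rho> (inv y) m) \<in> M" if "set ys \<subseteq> carrier H" for ys
    using that by (induction ys) (auto simp: assms(1))
  with Cons show ?case by (auto simp: conjugate_def assms(1))
qed simp

lemma B_hat_P: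
  assumes "H \<in> B_hat n" "set ys \<subseteq> carrier H" "\<And>m. m \<in> M \<Longrightarrow> (\<Sum>y\<leftarrow>ys. \<rho> (inv y) m) = 0"
  shows "P \<in> B_hat (n * length ys)"
proof -
  have "P \<in> B_hat (n * length (map (Pair (0::'m)) ys))"
  proof (rule proj.B_hat_extension[OF proj_surj assms(1)])
    show "set (map (Pair 0) ys) \<subseteq> carrier P"
      using assms(2) by auto
    fix x assume "x \<in> kernel P H snd"
    then show "conjugate_prod P (map (Pair 0) ys) x = \<one>\<^bsub>P\<^esub>"
      using conjugate_prod_P_fiber[OF _ assms(2)] assms(3) by (auto simp: kernel_proj simp del: map_map)
  qed
  then show ?thesis by simp
qed

text \<open>The hypothesis \<open>gen\<close> says that T generates M as a module. Inside P the
  action is conjugation by \<open>(0, h)\<close>, so the elements m with \<open>(m, \<one>)\<close>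
  generated form a set N of the required kind.\<close>

lemma finitely_generated_P:
  assumes "finitely_generated_group H" "finite T" "T \<subseteq> M"
    and gen: "\<And>N. T \<subseteq> N \<Longrightarrow> 0 \<in> N \<Longrightarrow> (\<And>m n. m \<in> N \<Longrightarrow> n \<in> N \<Longrightarrow> m + n \<in> N)
      \<Longrightarrow> (\<And>m. m \<in> N \<Longrightarrow> - m \<in> N) \<Longrightarrow> (\<And>h m. h \<in> carrier H \<Longrightarrow> m \<in> N \<Longrightarrow> \<rho> h m \<in> N) \<Longrightarrow> M \<subseteq> N"
  shows "finitely_generated_group P"
proof -
  from assms(1) obtain S where S: "finite S" "S \<subseteq> carrier H" "generate H S = carrier H"
    unfolding finitely_generated_group_def by blast
  define U where "U = Pair 0 ` S \<union> T \<times> {\<one>}"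
  have U: "finite U" "U \<subseteq> carrier P"
    using S(1,2) assms(2,3) by (auto simp: U_def)
  let ?gen = "generate P U"
  have "Pair 0 \<in> hom H P"
    by (rule homI) simp_all
  then have incl: "group_hom H P (Pair 0)"
    by (intro group_hom.intro group_hom_axioms.intro is_group group_P)
  have "Pair 0 ` carrier H = generate P (Pair 0 ` S)"
    using group_hom.generate_img[OF incl S(2)] S(3) by simp
  then have compl: "(0, h) \<in> ?gen" if "h \<in> carrier H" for h
    using that P.mono_generate[of "Pair 0 ` S" U] by (auto simp: U_def)
  define N where "N = {m \<in> M. (m, \<one>) \<in> ?gen}"
  have "M \<subseteq> N"
  proof (rule gen)
    show "T \<subseteq> N"
      using assms(3) by (auto simp: N_def U_def intro: generate.incl)
    show "0 \<in> N"
      using compl by (simp add: N_def)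
  next
    fix m n assume "m \<in> N" "n \<in> N"
    then show "m + n \<in> N"
      using generate.eng[of "(m, \<one>)" P U "(n, \<one>)"] by (simp add: N_def)
  next
    fix m assume "m \<in> N"
    then show "- m \<in> N"
      using P.generate_m_inv_closed[OF U(2), of "(m, \<one>)"] by (simp add: N_def)
  next
    fix h m assume h: "h \<in> carrier H" and m: "m \<in> N"
    then have "(0, h) \<otimes>\<^bsub>P\<^esub> (m, \<one>) \<otimes>\<^bsub>P\<^esub> (0, inv h) \<in> ?gen"
      using compl by (auto simp: N_def intro!: generate.eng simp del: mult_P)
    then show "\<rho> h m \<in> N"
      using h m by (simp add: N_def)
  qed
  then have "kernel P H snd \<subseteq> ?gen"
    by (auto simp: kernel_proj N_def)
  moreover have "generate H (snd ` U) = carrier H"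
  proof
    show "generate H (snd ` U) \<subseteq> carrier H"
      using U(2) by (intro generate_incl) auto
    have "S \<subseteq> snd ` U" by (force simp: U_def)
    then show "carrier H \<subseteq> generate H (snd ` U)"
      using mono_generate S(3) by blast
  qed
  ultimately have "?gen = carrier P"
    using proj.generate_eq_carrier_extension U(2) by blast
  then show ?thesis
    unfolding finitely_generated_group_def using U group_P by blast
qed

text \<open>The hypothesis on n says that \<open>(1 - h)^2\<close> does not annihilate n. The d-th
  derived subgroup of P is normal and contains some \<open>(m, h)\<close>; if it were abelian, this
  element would commute with its conjugate by \<open>(n, \<one>)\<close>. The unknown m cancels and
  leaves \<open>(1 - h)^2 n = 0\<close>.\<close>

lemma derived_P_nontrivial:
  assumes h: "h \<in> (derived H ^^ d) (carrier H)"
    and n: "n \<in> M" "n - \<rho> h n \<noteq> \<rho> h (n - \<rho> h n)"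
  shows "(derived P ^^ Suc d) (carrier P) \<noteq> {\<one>\<^bsub>P\<^esub>}"
proof
  let ?D = "(derived P ^^ d) (carrier P)"
  assume "(derived P ^^ Suc d) (carrier P) = {\<one>\<^bsub>P\<^esub>}"
  then have trivial: "generate P (derived_set P ?D) \<subseteq> {\<one>\<^bsub>P\<^esub>}"
    by (simp add: derived_def)
  have D: "?D \<lhd> P"
    by (induction d) (simp_all add: P.derived_is_normal P.normal_self del: carrier_P)
  have sub: "?D \<subseteq> carrier P"
    by (rule P.exp_of_derived_in_carrier) simp
  \<comment> \<open>Triviality of the next derived subgroup makes \<open>?D\<close> abelian.\<close>
  have comm: "a \<otimes>\<^bsub>P\<^esub> b = b \<otimes>\<^bsub>P\<^esub> a" if "a \<in> ?D" "b \<in> ?D" for a b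
  proof -
    have ab: "a \<in> carrier P" "b \<in> carrier P"
      using that sub by blast+
    have "a \<otimes>\<^bsub>P\<^esub> b \<otimes>\<^bsub>P\<^esub> inv\<^bsub>P\<^esub> a \<otimes>\<^bsub>P\<^esub> inv\<^bsub>P\<^esub> b \<in> derived_set P ?D"
      using that by blast
    then have "a \<otimes>\<^bsub>P\<^esub> b \<otimes>\<^bsub>P\<^esub> inv\<^bsub>P\<^esub> a \<otimes>\<^bsub>P\<^esub> inv\<^bsub>P\<^esub> b = \<one>\<^bsub>P\<^esub>"
      using trivial generate.incl[of _ "derived_set P ?D" P] by fast
    then show ?thesis
      using ab by (simp add: P.inv_solve_right' del: mult_P carrier_P one_P)
  qed
  have "h \<in> snd ` ?D"
    using proj.exp_of_derived_img[of "carrier P" d] h proj_surj by simp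
  then obtain m where g: "(m, h) \<in> ?D" by force
  then have mh: "m \<in> M" "h \<in> carrier H" using sub by auto
  have "(n, \<one>) \<otimes>\<^bsub>P\<^esub> (m, h) \<otimes>\<^bsub>P\<^esub> inv\<^bsub>P\<^esub> (n, \<one>) \<in> ?D"
    by (rule normal.inv_op_closed2[OF D _ g]) (simp add: n(1))
  then have "(n + m - \<rho> h n, h) \<in> ?D"
    using n(1) mh by (simp add: act_uminus)
  from comm[OF this g] have "n - \<rho> h n = \<rho> h n - \<rho> h (\<rho> h n)"
    using n(1) mh by (simp add: act_add act_diff algebra_simps)
  then show False
    using n(2) act_diff[OF mh(2) n(1) act_closed[OF mh(2) n(1)]] by simp
qed

end

section \<open>Direct products\<close>

lemma DirProd_snd_hom:
  assumes "group G" "group H"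
  shows "group_hom (G \<times>\<times> H) H snd"
  using assms by (auto simp: group_hom_def group_hom_axioms_def DirProd_group hom_def)

lemma DirProd_fst_hom:
  assumes "group G" "group H"
  shows "group_hom (G \<times>\<times> H) G fst"
  using assms by (auto simp: group_hom_def group_hom_axioms_def DirProd_group hom_def)

lemma DirProd_left_hom:
  assumes "group G" "group H"
  shows "group_hom G (G \<times>\<times> H) (\<lambda>g. (g, \<one>\<^bsub>H\<^esub>))"
proof -
  interpret H: group H by fact
  show ?thesis
    using assms by (auto simp: group_hom_def group_hom_axioms_def DirProd_group hom_def)
qed

lemma kernel_DirProd_snd:
  assumes "group H"
  shows "kernel (G \<times>\<times> H) H snd = (\<lambda>g. (g, \<one>\<^bsub>H\<^esub>)) ` carrier G"
proof -
  interpret H: group H by fact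
  show ?thesis by (auto simp: kernel_def)
qed

lemma DirProd_snd_surj:
  assumes "group G"
  shows "snd ` carrier (G \<times>\<times> H) = carrier H"
proof -
  interpret G: group G by fact
  show ?thesis using G.one_closed by force
qed

lemma torsion_free_DirProd:
  assumes "torsion_free_group G" "torsion_free_group H"
  shows "torsion_free_group (G \<times>\<times> H)"
proof -
  have gr: "group G" "group H"
    using assms by (auto simp: torsion_free_group_def)
  interpret p: group_hom "G \<times>\<times> H" H snd by (rule DirProd_snd_hom[OF gr])
  interpret q: group_hom "G \<times>\<times> H" G fst by (rule DirProd_fst_hom[OF gr])
  show ?thesis
  proof (rule p.torsion_free_extension[OF assms(2)])
    fix x and n :: nat
    assume x: "x \<in> kernel (G \<times>\<times> H) H snd" "n > 0" "x [^]\<^bsub>G \<times>\<times> H\<^esub> n = \<one>\<^bsub>G \<times>\<times> H\<^esub>"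
    then have "x \<in> kernel (G \<times>\<times> H) G fst"
      using q.hom_nat_pow_kernel[OF assms(1)] by (auto simp: kernel_def)
    then show "x = \<one>\<^bsub>G \<times>\<times> H\<^esub>"
      using x(1) by (simp add: kernel_def prod_eq_iff)
  qed
qed

lemma finitely_generated_DirProd:
  assumes "finitely_generated_group G" "finitely_generated_group H"
  shows "finitely_generated_group (G \<times>\<times> H)"
proof -
  have gr: "group G" "group H"
    using assms by (auto simp: finitely_generated_group_def)
  interpret G: group G by fact
  interpret H: group H by fact
  interpret p: group_hom "G \<times>\<times> H" H snd by (rule DirProd_snd_hom[OF gr])
  interpret l: group_hom G "G \<times>\<times> H" "\<lambda>g. (g, \<one>\<^bsub>H\<^esub>)" by (rule DirProd_left_hom[OF gr])
  obtain S where S: "finite S" "S \<subseteq> carrier G" "generate G S = carrier G"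
    using assms(1) unfolding finitely_generated_group_def by blast
  obtain T where T: "finite T" "T \<subseteq> carrier H" "generate H T = carrier H"
    using assms(2) unfolding finitely_generated_group_def by blast
  define U where "U = (\<lambda>g. (g, \<one>\<^bsub>H\<^esub>)) ` S \<union> Pair \<one>\<^bsub>G\<^esub> ` T"
  have U: "finite U" "U \<subseteq> carrier (G \<times>\<times> H)"
    using S(1,2) T(1,2) by (auto simp: U_def)
  have "generate (G \<times>\<times> H) U = carrier (G \<times>\<times> H)"
  proof (rule p.generate_eq_carrier_extension[OF U(2)])
    have "T \<subseteq> snd ` U" by (force simp: U_def)
    then have "carrier H \<subseteq> generate H (snd ` U)"
      using H.mono_generate T(3) by blast
    moreover have "generate H (snd ` U) \<subseteq> carrier H"
      using U(2) by (intro H.generate_incl) auto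
    ultimately show "generate H (snd ` U) = carrier H" by blast
    have "(\<lambda>g. (g, \<one>\<^bsub>H\<^esub>)) ` carrier G = generate (G \<times>\<times> H) ((\<lambda>g. (g, \<one>\<^bsub>H\<^esub>)) ` S)"
      using l.generate_img[OF S(2)] S(3) by simp
    also have "\<dots> \<subseteq> generate (G \<times>\<times> H) U"
      by (rule p.G.mono_generate) (simp add: U_def)
    finally show "kernel (G \<times>\<times> H) H snd \<subseteq> generate (G \<times>\<times> H) U"
      by (simp add: kernel_DirProd_snd[OF gr(2)])
  qed
  then show ?thesis
    unfolding finitely_generated_group_def using U p.G.is_group by blast
qed

lemma solvable_DirProd:
  assumes "group G" "group H" "solvable G" "solvable H"
  shows "solvable (G \<times>\<times> H)"
proof (rule group_hom.solvable_extension[OF DirProd_snd_hom[OF assms(1,2)] DirProd_snd_surj[OF assms(1)] assms(4)])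
  show "solvable_seq (G \<times>\<times> H) (kernel (G \<times>\<times> H) H snd)"
    using group_hom.solvable_imp_solvable_img[OF DirProd_left_hom[OF assms(1,2)]] assms(3)
    by (simp add: kernel_DirProd_snd[OF assms(2)] solvable_def)
qed

text \<open>The kernel of \<open>snd\<close> is a copy of G, and the identity of G itself kills
  it.\<close>

lemma B_hat_DirProd:
  assumes "G \<in> B_hat m" "H \<in> B_hat n"
  shows "G \<times>\<times> H \<in> B_hat (n * m)"
proof -
  have gr: "group G" "group H"
    using assms by (auto simp: B_hat_def)
  interpret l: group_hom G "G \<times>\<times> H" "\<lambda>g. (g, \<one>\<^bsub>H\<^esub>)" by (rule DirProd_left_hom[OF gr])
  obtain xs where xs: "length xs = m" "set xs \<subseteq> carrier G"
      "\<And>g. g \<in> carrier G \<Longrightarrow> conjugate_prod G xs g = \<one>\<^bsub>G\<^esub>"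
    using assms(1) unfolding B_hat_def by blast
  let ?ys = "map (\<lambda>g. (g, \<one>\<^bsub>H\<^esub>)) xs"
  have "G \<times>\<times> H \<in> B_hat (n * length ?ys)"
  proof (rule group_hom.B_hat_extension[OF DirProd_snd_hom[OF gr] DirProd_snd_surj[OF gr(1)] assms(2)])
    show "set ?ys \<subseteq> carrier (G \<times>\<times> H)"
      using xs(2) l.hom_closed by auto
    fix x assume "x \<in> kernel (G \<times>\<times> H) H snd"
    then obtain g where g: "g \<in> carrier G" "x = (g, \<one>\<^bsub>H\<^esub>)"
      by (auto simp: kernel_DirProd_snd[OF gr(2)])
    then show "conjugate_prod (G \<times>\<times> H) ?ys x = \<one>\<^bsub>G \<times>\<times> H\<^esub>"
      using l.hom_conjugate_prod[OF g(1) xs(2), symmetric]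
      by (simp only: g(2) xs(3)[OF g(1)] one_DirProd)
  qed
  then show ?thesis using xs(1) by simp
qed

section \<open>Twisted permutation modules\<close>

text \<open>The free abelian group on S, with basis \<open>delta\<close>; for the carrier of K it is
  the additive group of the integral group ring.\<close>

definition fin_supp_funs :: "'a set \<Rightarrow> ('a \<Rightarrow> int) set" where
  "fin_supp_funs S = {f. finite {x. f x \<noteq> 0} \<and> {x. f x \<noteq> 0} \<subseteq> S}"

definition delta :: "'a \<Rightarrow> 'a \<Rightarrow> int" where
  "delta a = (\<lambda>x. if x = a then 1 else 0)"

text \<open>Multiplying the argument on the right by k gives a left action; it sends
  \<open>delta a\<close> to \<open>\<chi> w\<close> times \<open>delta\<close> at a times the
  inverse of k. The value 0 off the carrier keeps supports inside it.\<close>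

definition twisted_translation ::
  "('a, 'c) monoid_scheme \<Rightarrow> ('b \<Rightarrow> int) \<Rightarrow> 'a \<times> 'b \<Rightarrow> ('a \<Rightarrow> int) \<Rightarrow> 'a \<Rightarrow> int" where
  "twisted_translation K \<chi> = (\<lambda>(k, w) f x. if x \<in> carrier K then \<chi> w * f (x \<otimes>\<^bsub>K\<^esub> k) else 0)"

lemma delta_in_fin_supp_funs [simp]: "a \<in> S \<Longrightarrow> delta a \<in> fin_supp_funs S"
  by (simp add: fin_supp_funs_def delta_def)

lemma fin_supp_funs_outside: "f \<in> fin_supp_funs S \<Longrightarrow> x \<notin> S \<Longrightarrow> f x = 0"
  by (auto simp: fin_supp_funs_def)

lemma fin_supp_funs_generated_by_deltas:
  assumes "0 \<in> N" and add: "\<And>m n. m \<in> N \<Longrightarrow> n \<in> N \<Longrightarrow> m + n \<in> N"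
    and uminus: "\<And>m. m \<in> N \<Longrightarrow> - m \<in> N" and delta: "\<And>a. a \<in> S \<Longrightarrow> delta a \<in> N"
  shows "fin_supp_funs S \<subseteq> N"
proof -
  have multiple: "(\<lambda>x. if x = a then c else 0) \<in> N" if a: "a \<in> S" for a and c :: int
  proof (induction c rule: int_induct[of _ 0])
    case base
    then show ?case using assms(1) by (simp add: zero_fun_def)
  next
    case (step1 c)
    have "(\<lambda>x. if x = a then c + 1 else 0) = (\<lambda>x. if x = a then c else 0) + delta a"
      by (auto simp: delta_def)
    then show ?case using add[OF step1(2) delta[OF a]] by simp
  next
    case (step2 c)
    have "(\<lambda>x. if x = a then c - 1 else 0) = (\<lambda>x. if x = a then c else 0) + - delta a"
      by (auto simp: delta_def)
    then show ?case using add[OF step2(2) uminus[OF delta[OF a]]] by simp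
  qed
  \<comment> \<open>A is any finite set containing the support, so the induction can clear one value
    with \<open>f(a := 0)\<close> without tracking the exact support.\<close>
  have "f \<in> N" if "finite A" "A \<subseteq> S" "\<And>x. x \<notin> A \<Longrightarrow> f x = 0" for A f
    using that
  proof (induction A arbitrary: f rule: finite_induct)
    case empty
    then have "f = 0" by auto
    show ?case unfolding \<open>f = 0\<close> by (rule assms(1))
  next
    case (insert a A)
    have "f(a := 0) \<in> N"
      using insert.prems by (intro insert.IH) auto
    moreover have "f = f(a := 0) + (\<lambda>x. if x = a then f a else 0)"
      by auto
    ultimately show ?case
      using add[OF _ multiple[of a "f a"], of "f(a := 0)"] insert.prems by auto
  qed
  then have "f \<in> N" if "finite {x. f x \<noteq> 0}" "{x. f x \<noteq> 0} \<subseteq> S" for f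
    using that by blast
  then show ?thesis
    unfolding fin_supp_funs_def by blast
qed

lemma sum_const_fun_apply: "(\<Sum>i<(n::nat). (f :: 'a \<Rightarrow> int)) x = int n * f x"
  by (induction n) (auto simp: algebra_simps)

lemma module_action_twisted_translation:
  assumes "group K" "group W"
    and \<chi>: "\<chi> \<one>\<^bsub>W\<^esub> = 1"
      "\<And>v w. v \<in> carrier W \<Longrightarrow> w \<in> carrier W \<Longrightarrow> \<chi> (v \<otimes>\<^bsub>W\<^esub> w) = \<chi> v * \<chi> w"
  shows "module_action (K \<times>\<times> W) (fin_supp_funs (carrier K)) (twisted_translation K \<chi>)"
proof -
  interpret K: group K by fact
  interpret W: group W by fact
  interpret KW: group "K \<times>\<times> W" by (rule DirProd_group) fact+
  show ?thesis
  proof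
    show "0 \<in> fin_supp_funs (carrier K)"
      by (simp add: fin_supp_funs_def)
    fix f g :: "'a \<Rightarrow> int" assume f: "f \<in> fin_supp_funs (carrier K)"
    show "- f \<in> fin_supp_funs (carrier K)"
      using f by (simp add: fin_supp_funs_def)
    show "twisted_translation K \<chi> \<one>\<^bsub>K \<times>\<times> W\<^esub> f = f"
      using f \<chi>(1) by (auto simp: twisted_translation_def fin_supp_funs_outside)
    assume g: "g \<in> fin_supp_funs (carrier K)"
    have "{x. (f + g) x \<noteq> 0} \<subseteq> {x. f x \<noteq> 0} \<union> {x. g x \<noteq> 0}" by auto
    moreover have "finite ({x. f x \<noteq> 0} \<union> {x. g x \<noteq> 0})" "{x. f x \<noteq> 0} \<union> {x. g x \<noteq> 0} \<subseteq> carrier K"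
      using f g by (simp_all add: fin_supp_funs_def)
    ultimately show "f + g \<in> fin_supp_funs (carrier K)"
      unfolding fin_supp_funs_def using finite_subset by blast
  next
    fix h and f :: "'a \<Rightarrow> int"
    assume h: "h \<in> carrier (K \<times>\<times> W)" and f: "f \<in> fin_supp_funs (carrier K)"
    obtain k w where kw: "h = (k, w)" "k \<in> carrier K" "w \<in> carrier W" using h by auto
    \<comment> \<open>The new support lies in the old one translated by the inverse of k, hence is
      finite.\<close>
    have "{x. twisted_translation K \<chi> h f x \<noteq> 0} \<subseteq> (\<lambda>y. y \<otimes>\<^bsub>K\<^esub> inv\<^bsub>K\<^esub> k) ` {y. f y \<noteq> 0}"
    proof
      fix x assume "x \<in> {x. twisted_translation K \<chi> h f x \<noteq> 0}"
      then have "x \<in> carrier K" "f (x \<otimes>\<^bsub>K\<^esub> k) \<noteq> 0"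
        by (auto simp: kw twisted_translation_def split: if_splits)
      then show "x \<in> (\<lambda>y. y \<otimes>\<^bsub>K\<^esub> inv\<^bsub>K\<^esub> k) ` {y. f y \<noteq> 0}"
        using kw(2) by (intro image_eqI[of _ _ "x \<otimes>\<^bsub>K\<^esub> k"]) (auto simp: K.m_assoc)
    qed
    moreover have "{x. twisted_translation K \<chi> h f x \<noteq> 0} \<subseteq> carrier K"
      by (auto simp: kw twisted_translation_def split: if_splits)
    ultimately show "twisted_translation K \<chi> h f \<in> fin_supp_funs (carrier K)"
      using f finite_surj unfolding fin_supp_funs_def by blast
    fix g :: "'a \<Rightarrow> int" assume "g \<in> fin_supp_funs (carrier K)"
    show "twisted_translation K \<chi> h (f + g) = twisted_translation K \<chi> h f + twisted_translation K \<chi> h g"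
      by (auto simp: twisted_translation_def algebra_simps split: prod.splits)
  next
    fix h h' and f :: "'a \<Rightarrow> int"
    assume "h \<in> carrier (K \<times>\<times> W)" "h' \<in> carrier (K \<times>\<times> W)" "f \<in> fin_supp_funs (carrier K)"
    then show "twisted_translation K \<chi> (h \<otimes>\<^bsub>K \<times>\<times> W\<^esub> h') f
        = twisted_translation K \<chi> h (twisted_translation K \<chi> h' f)"
      by (auto simp: twisted_translation_def \<chi>(2) K.m_assoc fun_eq_iff)
  qed
qed

section \<open>The twisted wreath product and its properties\<close>

text \<open>The restricted wreath product of the integers by K, enlarged by a factor W that acts on
  the base through the sign \<open>\<chi>\<close>.\<close>

definition twisted_wreath ::
  "('a, 'c) monoid_scheme \<Rightarrow> ('b, 'd) monoid_scheme \<Rightarrow> ('b \<Rightarrow> int) \<Rightarrow> (('a \<Rightarrow> int) \<times> 'a \<times> 'b) monoid" where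
  "twisted_wreath K W \<chi> = semidirect (fin_supp_funs (carrier K)) (K \<times>\<times> W) (twisted_translation K \<chi>)"

locale signed_pair = K: group K + W: group W
  for K :: "('a, 'c) monoid_scheme" and W :: "('b, 'd) monoid_scheme" +
  fixes \<chi> :: "'b \<Rightarrow> int" and w0 :: 'b
  assumes chi_one: "\<chi> \<one>\<^bsub>W\<^esub> = 1"
    and chi_mult: "v \<in> carrier W \<Longrightarrow> w \<in> carrier W \<Longrightarrow> \<chi> (v \<otimes>\<^bsub>W\<^esub> w) = \<chi> v * \<chi> w"
    and w0: "w0 \<in> carrier W" "\<chi> w0 = - 1"
begin

sublocale module_action "K \<times>\<times> W" "fin_supp_funs (carrier K)" "twisted_translation K \<chi>"
  using module_action_twisted_translation[OF K.is_group W.is_group chi_one chi_mult] .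

lemma torsion_free_twisted_wreath:
  assumes "torsion_free_group K" "torsion_free_group W"
  shows "torsion_free_group (twisted_wreath K W \<chi>)"
  unfolding twisted_wreath_def
proof (rule torsion_free_P[OF torsion_free_DirProd[OF assms]])
  fix f :: "'a \<Rightarrow> int" and n :: nat
  assume n: "n > 0" and zero: "(\<Sum>i<n. f) = 0"
  have "int n * f x = 0" for x
    using fun_cong[OF zero, of x] by (simp only: sum_const_fun_apply zero_fun_apply)
  then show "f = 0" using n by auto
qed

lemma solvable_twisted_wreath:
  assumes "solvable K" "solvable W"
  shows "solvable (twisted_wreath K W \<chi>)"
  unfolding twisted_wreath_def
  by (rule solvable_P[OF solvable_DirProd[OF K.is_group W.is_group assms]])

lemma chi_inv_w0: "\<chi> (inv\<^bsub>W\<^esub> w0) = - 1"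
  using chi_mult[of w0 "inv\<^bsub>W\<^esub> w0"] w0 chi_one by simp

lemma B_hat_twisted_wreath:
  assumes "K \<in> B_hat m" "W \<in> B_hat n"
  shows "twisted_wreath K W \<chi> \<in> B_hat (n * m * 2)"
proof -
  \<comment> \<open>On the base the two coefficients act as 1 and -1, so their word vanishes there;
    this is the factor 2 in the degree.\<close>
  let ?ys = "[\<one>\<^bsub>K \<times>\<times> W\<^esub>, (\<one>\<^bsub>K\<^esub>, w0)]"
  have "P \<in> B_hat (n * m * length ?ys)"
  proof (rule B_hat_P[OF B_hat_DirProd[OF assms]])
    show "set ?ys \<subseteq> carrier (K \<times>\<times> W)" using w0 by simp
    fix f :: "'a \<Rightarrow> int" assume f: "f \<in> fin_supp_funs (carrier K)"
    have "twisted_translation K \<chi> (\<one>\<^bsub>K\<^esub>, inv\<^bsub>W\<^esub> w0) f = - f"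
      using f by (auto simp: twisted_translation_def chi_inv_w0 fin_supp_funs_outside)
    moreover have "twisted_translation K \<chi> (\<one>\<^bsub>K\<^esub>, \<one>\<^bsub>W\<^esub>) f = f"
      using act_one[OF f] by simp
    ultimately show "(\<Sum>y\<leftarrow>?ys. twisted_translation K \<chi> (inv\<^bsub>K \<times>\<times> W\<^esub> y) f) = 0"
      using w0 K.is_group W.is_group by simp
  qed
  then show ?thesis by (simp add: twisted_wreath_def mult_2_right)
qed

text \<open>Hence \<open>delta \<one>\<close> alone generates the base as a module. The inverse
  appears because translation acts on the argument.\<close>

lemma translate_delta:
  assumes "k \<in> carrier K"
  shows "twisted_translation K \<chi> (inv\<^bsub>K\<^esub> k, \<one>\<^bsub>W\<^esub>) (delta \<one>\<^bsub>K\<^esub>) = delta k"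
proof
  fix x
  have "x \<otimes>\<^bsub>K\<^esub> inv\<^bsub>K\<^esub> k = \<one>\<^bsub>K\<^esub> \<longleftrightarrow> x = k" if "x \<in> carrier K"
    using that assms by (simp add: K.inv_solve_right')
  then show "twisted_translation K \<chi> (inv\<^bsub>K\<^esub> k, \<one>\<^bsub>W\<^esub>) (delta \<one>\<^bsub>K\<^esub>) x = delta k x"
    using assms by (auto simp: twisted_translation_def delta_def chi_one)
qed

lemma finitely_generated_twisted_wreath:
  assumes "finitely_generated_group K" "finitely_generated_group W"
  shows "finitely_generated_group (twisted_wreath K W \<chi>)"
  unfolding twisted_wreath_def
proof (rule finitely_generated_P[OF finitely_generated_DirProd[OF assms], of "{delta \<one>\<^bsub>K\<^esub>}"])
  fix N :: "('a \<Rightarrow> int) set"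
  assume N: "{delta \<one>\<^bsub>K\<^esub>} \<subseteq> N" "0 \<in> N" "\<And>m n. m \<in> N \<Longrightarrow> n \<in> N \<Longrightarrow> m + n \<in> N"
    "\<And>m. m \<in> N \<Longrightarrow> - m \<in> N"
    "\<And>h m. h \<in> carrier (K \<times>\<times> W) \<Longrightarrow> m \<in> N \<Longrightarrow> twisted_translation K \<chi> h m \<in> N"
  have "delta k \<in> N" if "k \<in> carrier K" for k
    using N(5)[of "(inv\<^bsub>K\<^esub> k, \<one>\<^bsub>W\<^esub>)" "delta \<one>\<^bsub>K\<^esub>"] N(1) that by (simp add: translate_delta)
  then show "fin_supp_funs (carrier K) \<subseteq> N"
    using fin_supp_funs_generated_by_deltas[OF N(2-4)] by blast
qed simp_all

lemma derived_twisted_wreath_nontrivial: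
  assumes "(derived K ^^ d) (carrier K) \<noteq> {\<one>\<^bsub>K\<^esub>}"
  shows "(derived (twisted_wreath K W \<chi>) ^^ Suc d) (carrier (twisted_wreath K W \<chi>))
    \<noteq> {\<one>\<^bsub>twisted_wreath K W \<chi>\<^esub>}"
proof -
  interpret fst: group_hom "K \<times>\<times> W" K fst
    by (rule DirProd_fst_hom[OF K.is_group W.is_group])
  have sub: "subgroup ((derived K ^^ d) (carrier K)) K"
    by (rule K.exp_of_derived_is_subgroup[OF K.subgroup_self])
  then obtain k where k: "k \<in> (derived K ^^ d) (carrier K)" "k \<noteq> \<one>\<^bsub>K\<^esub>"
    using assms subgroup.one_closed by blast
  have kK: "k \<in> carrier K" using sub k(1) by (rule subgroup.mem_carrier)
  have "fst ` carrier (K \<times>\<times> W) = carrier K"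
    using W.one_closed by force
  then have "k \<in> fst ` ((derived (K \<times>\<times> W) ^^ d) (carrier (K \<times>\<times> W)))"
    using fst.exp_of_derived_img[of "carrier (K \<times>\<times> W)" d] k(1) by simp
  then obtain w where kw: "(k, w) \<in> (derived (K \<times>\<times> W) ^^ d) (carrier (K \<times>\<times> W))"
    by force
  let ?e = "delta \<one>\<^bsub>K\<^esub>" and ?act = "twisted_translation K \<chi> (k, w)"
  \<comment> \<open>Both sides are compared at the identity of K. Since k is not the identity, the
    left side is 1 there; the right side is \<open>- (\<chi> w)^2\<close> if k squares to the
    identity and 0 otherwise.\<close>
  have "(?e - ?act ?e) \<one>\<^bsub>K\<^esub> = 1"
    using k(2) kK by (simp add: twisted_translation_def delta_def)
  moreover have "?act (?e - ?act ?e) \<one>\<^bsub>K\<^esub> \<le> 0"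
    using k(2) kK by (simp add: twisted_translation_def delta_def)
  ultimately have "?e - ?act ?e \<noteq> ?act (?e - ?act ?e)"
    by (metis not_one_le_zero)
  then show ?thesis
    unfolding twisted_wreath_def using derived_P_nontrivial[OF kw, of ?e] by simp
qed

text \<open>The witness is the base. Finitely many of its elements have a finite joint support;
  whatever they generate vanishes at a point k outside it, but \<open>delta k\<close> does
  not.\<close>

lemma twisted_wreath_infinitely_generated_subgroup:
  assumes "infinite (carrier K)"
  shows "\<exists>S. subgroup S (twisted_wreath K W \<chi>) \<and> \<not> finitely_generated_subset (twisted_wreath K W \<chi>) S"
proof (intro exI conjI)
  let ?M = "fin_supp_funs (carrier K)" and ?u = "\<one>\<^bsub>K \<times>\<times> W\<^esub>"
  show "subgroup (?M \<times> {?u}) (twisted_wreath K W \<chi>)"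
    using proj.subgroup_kernel unfolding twisted_wreath_def kernel_proj .
  show "\<not> finitely_generated_subset (twisted_wreath K W \<chi>) (?M \<times> {?u})"
    unfolding twisted_wreath_def
  proof
    assume "finitely_generated_subset P (?M \<times> {?u})"
    then obtain F where F: "finite F" "F \<subseteq> ?M \<times> {?u}" "generate P F = ?M \<times> {?u}"
      unfolding finitely_generated_subset_def by blast
    have "finite (\<Union>(f, h)\<in>F. {x. f x \<noteq> 0})"
      using F(1,2) by (fastforce simp: fin_supp_funs_def)
    then obtain k where k: "k \<in> carrier K" "k \<notin> (\<Union>(f, h)\<in>F. {x. f x \<noteq> 0})"
      using assms by (meson finite_subset subsetI)
    let ?N = "{f \<in> ?M. f k = 0} \<times> {?u}"
    have "subgroup ?N P"
    proof
      fix x assume "x \<in> ?N"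
      then obtain f where f: "x = (f, ?u)" "f \<in> ?M" "f k = 0" by blast
      have "inv\<^bsub>P\<^esub> x = (- f, ?u)"
        unfolding f(1) by (rule inv_P_fiber[OF f(2)])
      then show "inv\<^bsub>P\<^esub> x \<in> ?N"
        using f uminus_closed[OF f(2)] by simp
    next
      fix x y assume "x \<in> ?N" "y \<in> ?N"
      then obtain f g where fg: "x = (f, ?u)" "f \<in> ?M" "f k = 0" "y = (g, ?u)" "g \<in> ?M" "g k = 0"
        by blast
      have "x \<otimes>\<^bsub>P\<^esub> y = (f + g, ?u)"
        using fg act_one[OF fg(5)] by simp
      then show "x \<otimes>\<^bsub>P\<^esub> y \<in> ?N"
        using fg add_closed[OF fg(2,5)] by simp
    qed auto
    moreover have "F \<subseteq> ?N"
      using F(2) k(2) by fastforce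
    ultimately have "generate P F \<subseteq> ?N"
      by (intro P.generate_subgroup_incl)
    then have "?M \<times> {?u} \<subseteq> ?N"
      unfolding F(3) .
    then have "(delta k, ?u) \<in> ?N"
      using delta_in_fin_supp_funs[OF k(1)] by blast
    then show False
      by (simp add: delta_def)
  qed
qed

end

text \<open>A function is determined by its graph over the support, which is a finite subset of a
  countable type.\<close>

lemma countable_fin_supp_funs: "countable (fin_supp_funs (S :: 'a::countable set))"
proof (rule countableI')
  let ?graph = "\<lambda>f::'a \<Rightarrow> int. (\<lambda>x. (x, f x)) ` {x. f x \<noteq> 0}"
  show "inj_on (\<lambda>f. to_nat_on (Collect finite) (?graph f)) (fin_supp_funs S)"
  proof (rule inj_onI)
    fix f g :: "'a \<Rightarrow> int"
    assume fg: "f \<in> fin_supp_funs S" "g \<in> fin_supp_funs S"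
      "to_nat_on (Collect finite) (?graph f) = to_nat_on (Collect finite) (?graph g)"
    then have eq: "?graph f = ?graph g"
      by (intro inj_onD[OF inj_on_to_nat_on[OF countable_Collect_finite]])
        (auto simp: fin_supp_funs_def)
    show "f = g"
    proof
      fix x
      have "(x, y) \<in> ?graph f \<longleftrightarrow> y = f x \<and> y \<noteq> 0" "(x, y) \<in> ?graph g \<longleftrightarrow> y = g x \<and> y \<noteq> 0" for y
        by auto
      then show "f x = g x" using eq by metis
    qed
  qed
qed

section \<open>The Hantzsche--Wendt group\<close>

definition parity_sign :: "int \<Rightarrow> int" where
  "parity_sign n = (if even n then 1 else - 1)"

lemma odd_parity_sign [simp]: "odd (parity_sign a)"
  by (simp add: parity_sign_def)

text \<open>Multiplying by an odd sign does not change parity, so the twists in the group law below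
  are invisible to \<open>parity_sign\<close>. This makes the rotation part multiplicative and gives
  associativity.\<close>

lemma parity_sign_add_mult [simp]:
  "parity_sign (a + parity_sign b * c) = parity_sign a * parity_sign c"
  by (simp add: parity_sign_def)

text \<open>The group of isometries \<open>x \<mapsto> D x + (u, v, w)/2\<close> of \<open>\<real>\<^sup>3\<close> with \<open>u + v + w\<close> even, where the
  diagonal rotation \<open>D\<close> is determined by the parities of the translation part:
  \<open>D = diag ((-1)\<^sup>v, (-1)\<^sup>w, (-1)\<^sup>u)\<close>.\<close>

definition hantzsche_wendt :: "(int \<times> int \<times> int) monoid" where
  "hantzsche_wendt = \<lparr>carrier = {(u, v, w). even (u + v + w)},
     monoid.mult = (\<lambda>(u, v, w) (u', v', w').
       (u + parity_sign v * u', v + parity_sign w * v', w + parity_sign u * w')),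
     one = (0, 0, 0)\<rparr>"

lemma carrier_hantzsche_wendt [simp]: "(u, v, w) \<in> carrier hantzsche_wendt \<longleftrightarrow> even (u + v + w)"
  by (simp add: hantzsche_wendt_def)

lemma one_hantzsche_wendt [simp]: "\<one>\<^bsub>hantzsche_wendt\<^esub> = (0, 0, 0)"
  by (simp add: hantzsche_wendt_def)

lemma mult_hantzsche_wendt [simp]: "(u, v, w) \<otimes>\<^bsub>hantzsche_wendt\<^esub> (u', v', w') =
    (u + parity_sign v * u', v + parity_sign w * v', w + parity_sign u * w')"
  by (simp add: hantzsche_wendt_def)

lemma hantzsche_wendt_left_inverse:
  "(- parity_sign v * u, - parity_sign w * v, - parity_sign u * w) \<otimes>\<^bsub>hantzsche_wendt\<^esub> (u, v, w) = (0, 0, 0)"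
  by (simp add: parity_sign_def)

lemma group_hantzsche_wendt: "group hantzsche_wendt"
proof (rule groupI)
  fix x assume "x \<in> carrier hantzsche_wendt"
  moreover obtain u v w where x: "x = (u, v, w)" by (cases x)
  ultimately have "(- parity_sign v * u, - parity_sign w * v, - parity_sign u * w) \<in> carrier hantzsche_wendt"
    by auto
  then show "\<exists>y\<in>carrier hantzsche_wendt. y \<otimes>\<^bsub>hantzsche_wendt\<^esub> x = \<one>\<^bsub>hantzsche_wendt\<^esub>"
    using hantzsche_wendt_left_inverse[of v u w] unfolding x one_hantzsche_wendt by blast
next
  fix x y assume "x \<in> carrier hantzsche_wendt" "y \<in> carrier hantzsche_wendt"
  then show "x \<otimes>\<^bsub>hantzsche_wendt\<^esub> y \<in> carrier hantzsche_wendt"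
    by (cases x; cases y) auto
next
  fix x y z :: "int \<times> int \<times> int"
  show "x \<otimes>\<^bsub>hantzsche_wendt\<^esub> y \<otimes>\<^bsub>hantzsche_wendt\<^esub> z = x \<otimes>\<^bsub>hantzsche_wendt\<^esub> (y \<otimes>\<^bsub>hantzsche_wendt\<^esub> z)"
    by (cases x; cases y; cases z) (simp add: distrib_left mult.assoc add.assoc)
qed (auto simp: parity_sign_def)

interpretation W: group hantzsche_wendt
  by (rule group_hantzsche_wendt)

lemma inv_hantzsche_wendt:
  assumes "even (u + v + w)"
  shows "inv\<^bsub>hantzsche_wendt\<^esub> (u, v, w) = (- parity_sign v * u, - parity_sign w * v, - parity_sign u * w)"
  using assms hantzsche_wendt_left_inverse by (intro W.inv_equality) (auto simp: parity_sign_def)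

lemma pow_hantzsche_wendt_lattice:
  assumes "even u" "even v" "even w"
  shows "(u, v, w) [^]\<^bsub>hantzsche_wendt\<^esub> (n::nat) = (int n * u, int n * v, int n * w)"
  using assms by (induction n) (simp_all add: parity_sign_def algebra_simps)

text \<open>The square of any element is a pure translation, that is, has even coordinates, and
  powers of translations are multiples. So a torsion element has trivial square.\<close>

lemma torsion_free_hantzsche_wendt: "torsion_free_group hantzsche_wendt"
  unfolding torsion_free_group_def
proof (intro conjI ballI allI impI, rule group_hantzsche_wendt)
  fix x and n :: nat
  assume x: "x \<in> carrier hantzsche_wendt"
    and n: "n > 0 \<and> x [^]\<^bsub>hantzsche_wendt\<^esub> n = \<one>\<^bsub>hantzsche_wendt\<^esub>"
  obtain u v w where uvw: "x = (u, v, w)" by (cases x)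
  have "(x \<otimes>\<^bsub>hantzsche_wendt\<^esub> x) [^]\<^bsub>hantzsche_wendt\<^esub> n = \<one>\<^bsub>hantzsche_wendt\<^esub>"
    using W.pow_mult_distrib[OF refl x x, of n] n W.one_closed W.r_one by metis
  moreover have "x \<otimes>\<^bsub>hantzsche_wendt\<^esub> x = (u + parity_sign v * u, v + parity_sign w * v, w + parity_sign u * w)"
    by (simp add: uvw)
  moreover have "even (u + parity_sign v * u)" "even (v + parity_sign w * v)" "even (w + parity_sign u * w)"
    by (auto simp: parity_sign_def)
  ultimately have "u + parity_sign v * u = 0" "v + parity_sign w * v = 0" "w + parity_sign u * w = 0"
    using n by (auto simp: pow_hantzsche_wendt_lattice)
  \<comment> \<open>A nonzero coordinate would force all three to be odd.\<close>
  then show "x = \<one>\<^bsub>hantzsche_wendt\<^esub>"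
    using x by (auto simp: uvw parity_sign_def split: if_splits)
qed

text \<open>The coefficients represent the four rotation parts. Taking each twice makes the word a
  product of conjugates of the square of g, which is a translation. These conjugates are its images
  under the four diagonal rotations, whose sum is the zero matrix.\<close>

lemma B_hat_hantzsche_wendt: "hantzsche_wendt \<in> B_hat 8"
proof -
  let ?xs = "[(0, 0, 0), (0, 0, 0), (1, 0, 1), (1, 0, 1), (1, 1, 0), (1, 1, 0), (0, 1, 1), (0, 1, 1)]
    :: (int \<times> int \<times> int) list"
  have "conjugate_prod hantzsche_wendt ?xs g = \<one>\<^bsub>hantzsche_wendt\<^esub>"
    if "g \<in> carrier hantzsche_wendt" for g
  proof -
    obtain u v w where g: "g = (u, v, w)" by (cases g)
    show ?thesis
      using that unfolding g
      by (cases "even u"; cases "even v"; cases "even w")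
        (simp_all add: conjugate_def inv_hantzsche_wendt parity_sign_def)
  qed
  moreover have "set ?xs \<subseteq> carrier hantzsche_wendt" "length ?xs = 8" by simp_all
  ultimately show ?thesis
    unfolding B_hat_def using group_hantzsche_wendt by blast
qed

lemma finitely_generated_hantzsche_wendt: "finitely_generated_group hantzsche_wendt"
proof -
  \<comment> \<open>Representatives of the three nontrivial rotation parts, then a basis of the
    translation lattice.\<close>
  define S :: "(int \<times> int \<times> int) set" where
    "S = {(1, 0, 1), (1, 1, 0), (0, 1, 1), (2, 0, 0), (0, 2, 0), (0, 0, 2)}"
  have S: "S \<subseteq> carrier hantzsche_wendt" by (simp add: S_def)
  let ?gen = "generate hantzsche_wendt S"
  have mult: "x \<otimes>\<^bsub>hantzsche_wendt\<^esub> y \<in> ?gen" if "x \<in> ?gen" "y \<in> ?gen" for x y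
    using that by (rule generate.eng)
  have axis: "(2 * i, 0, 0) \<in> ?gen" "(0, 2 * i, 0) \<in> ?gen" "(0, 0, 2 * i) \<in> ?gen" for i
  proof -
    have base: "(2, 0, 0) \<in> ?gen" "(0, 2, 0) \<in> ?gen" "(0, 0, 2) \<in> ?gen"
      by (rule generate.incl, simp add: S_def)+
    then have neg: "(- 2, 0, 0) \<in> ?gen" "(0, - 2, 0) \<in> ?gen" "(0, 0, - 2) \<in> ?gen"
      using W.generate_m_inv_closed[OF S, of "(2, 0, 0)"] W.generate_m_inv_closed[OF S, of "(0, 2, 0)"]
        W.generate_m_inv_closed[OF S, of "(0, 0, 2)"]
      by (simp_all add: inv_hantzsche_wendt parity_sign_def)
    have "(2 * i, 0, 0) \<in> ?gen \<and> (0, 2 * i, 0) \<in> ?gen \<and> (0, 0, 2 * i) \<in> ?gen"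
    proof (induction i rule: int_induct[of _ 0])
      case base
      then show ?case using generate.one[of hantzsche_wendt S] by simp
    next
      case (step1 i)
      then show ?case
        using mult[OF base(1), of "(2 * i, 0, 0)"] mult[OF base(2), of "(0, 2 * i, 0)"]
          mult[OF base(3), of "(0, 0, 2 * i)"]
        by (simp add: parity_sign_def algebra_simps)
    next
      case (step2 i)
      then show ?case
        using mult[OF neg(1), of "(2 * i, 0, 0)"] mult[OF neg(2), of "(0, 2 * i, 0)"]
          mult[OF neg(3), of "(0, 0, 2 * i)"]
        by (simp add: parity_sign_def algebra_simps)
    qed
    then show "(2 * i, 0, 0) \<in> ?gen" "(0, 2 * i, 0) \<in> ?gen" "(0, 0, 2 * i) \<in> ?gen" by auto
  qed
  have lattice: "(2 * i, 2 * j, 2 * k) \<in> ?gen" for i j k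
    using mult[OF mult[OF axis(1)[of i] axis(2)[of j]] axis(3)[of k]] by (simp add: parity_sign_def)
  have "x \<in> ?gen" if x: "x \<in> carrier hantzsche_wendt" for x
  proof -
    obtain u v w where uvw: "x = (u, v, w)" by (cases x)
    \<comment> \<open>The residues modulo 2 form a coset representative. A translation multiplied
      from the left introduces no signs, so x is the translation by the doubled quotients times this
      representative.\<close>
    have "(u mod 2, v mod 2, w mod 2) \<in> insert \<one>\<^bsub>hantzsche_wendt\<^esub> S"
      using x by (cases "even u"; cases "even v"; cases "even w")
        (simp_all add: uvw S_def even_iff_mod_2_eq_zero [symmetric] odd_iff_mod_2_eq_one [symmetric])
    then have "(u mod 2, v mod 2, w mod 2) \<in> ?gen"
      by (auto intro: generate.incl generate.one simp del: one_hantzsche_wendt)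
    from mult[OF lattice this, of "u div 2" "v div 2" "w div 2"] show ?thesis
      by (simp add: uvw parity_sign_def)
  qed
  then have "?gen = carrier hantzsche_wendt"
    using W.generate_incl[OF S] by blast
  moreover have "finite S" by (simp add: S_def)
  ultimately show ?thesis
    unfolding finitely_generated_group_def using S group_hantzsche_wendt by blast
qed

text \<open>Diagonal rotations commute, so all commutators lie in the abelian lattice
  \<open>?L\<close> of translations, and the second derived subgroup is trivial.\<close>

lemma solvable_hantzsche_wendt: "solvable hantzsche_wendt"
proof -
  let ?L = "{(u, v, w). even u \<and> even v \<and> even w} :: (int \<times> int \<times> int) set"
  have L: "subgroup ?L hantzsche_wendt"
  proof
    fix x assume "x \<in> ?L"
    then show "inv\<^bsub>hantzsche_wendt\<^esub> x \<in> ?L"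
      by (auto simp: inv_hantzsche_wendt)
  qed (auto simp: parity_sign_def)
  have "derived_set hantzsche_wendt (carrier hantzsche_wendt) \<subseteq> ?L"
    by (auto simp: inv_hantzsche_wendt parity_sign_def)
  then have "derived hantzsche_wendt (carrier hantzsche_wendt) \<subseteq> ?L"
    unfolding derived_def by (rule W.generate_subgroup_incl[OF _ L])
  then have "(derived hantzsche_wendt ^^ 2) (carrier hantzsche_wendt) \<subseteq> derived hantzsche_wendt ?L"
    using W.mono_derived by (simp add: numeral_2_eq_2)
  also have "\<dots> \<subseteq> {\<one>\<^bsub>hantzsche_wendt\<^esub>}"
    unfolding derived_def
    by (rule W.generate_subgroup_incl[OF _ W.triv_subgroup])
      (auto simp: inv_hantzsche_wendt parity_sign_def)
  finally have "(derived hantzsche_wendt ^^ 2) (carrier hantzsche_wendt) = {\<one>\<^bsub>hantzsche_wendt\<^esub>}"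
    using subgroup.one_closed[OF W.exp_of_derived_is_subgroup[OF W.subgroup_self]] by blast
  then show ?thesis
    using W.solvable_iff_trivial_derived_seq by blast
qed

text \<open>The sign of u is the third diagonal entry of the rotation part, hence multiplicative; it
  is -1 at the screw motion \<open>(1, 0, 1)\<close>.\<close>

lemma signed_pair_hantzsche_wendt:
  assumes "group K"
  shows "signed_pair K hantzsche_wendt (\<lambda>(u, v, w). parity_sign u) (1, 0, 1)"
proof -
  interpret K: group K by fact
  show ?thesis
    by unfold_locales (auto simp: parity_sign_def)
qed

section \<open>Iterating the construction\<close>

text \<open>The invariant of the iteration; its last clause encodes derived length greater than d.
  Failure of polycyclicity is left out: each step supplies it anew, and the starting group is
  polycyclic.\<close>

definition iterable :: "nat \<Rightarrow> ('a, 'b) monoid_scheme \<Rightarrow> bool" where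
  "iterable d G \<longleftrightarrow> finitely_generated_group G \<and> torsion_free_group G \<and> solvable G \<and>
     (\<exists>n>0. G \<in> B_hat n) \<and> (derived G ^^ d) (carrier G) \<noteq> {\<one>\<^bsub>G\<^esub>}"

section \<open>Transfer along surjections and isomorphisms\<close>

lemma (in group_hom) surj_finitely_generated:
  assumes "h ` carrier G = carrier H" "finitely_generated_group G"
  shows "finitely_generated_group H"
  using assms generate_img H.is_group unfolding finitely_generated_group_def
  by (metis finite_imageI image_mono)

lemma (in group_hom) surj_B_hat:
  assumes "h ` carrier G = carrier H" "G \<in> B_hat n"
  shows "H \<in> B_hat n"
proof -
  obtain xs where xs: "length xs = n" "set xs \<subseteq> carrier G"
      "\<And>g. g \<in> carrier G \<Longrightarrow> conjugate_prod G xs g = \<one>"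
    using assms(2) unfolding B_hat_def by blast
  have "conjugate_prod H (map h xs) g = \<one>\<^bsub>H\<^esub>" if "g \<in> carrier H" for g
  proof -
    have "g \<in> h ` carrier G" using that assms(1) by simp
    then obtain g' where g': "g' \<in> carrier G" "g = h g'" by blast
    show ?thesis
      unfolding g'(2) hom_conjugate_prod[OF g'(1) xs(2), symmetric] xs(3)[OF g'(1)] by (rule hom_one)
  qed
  moreover have "set (map h xs) \<subseteq> carrier H" "length (map h xs) = n"
    using xs by auto
  ultimately show ?thesis
    unfolding B_hat_def using H.is_group by blast
qed

lemma (in group_hom) iterable_iso:
  assumes surj: "h ` carrier G = carrier H" and inj: "inj_on h (carrier G)" and "iterable d G"
  shows "iterable d H"
proof -
  have "torsion_free_group H"
    unfolding torsion_free_group_def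
  proof (intro conjI ballI allI impI, rule H.is_group)
    fix y and n :: nat
    assume y: "y \<in> carrier H" "n > 0 \<and> y [^]\<^bsub>H\<^esub> n = \<one>\<^bsub>H\<^esub>"
    then obtain x where x: "x \<in> carrier G" "y = h x" using surj by blast
    then have "h (x [^] n) = h \<one>" using y by (simp add: hom_nat_pow)
    then have "x [^] n = \<one>" using x(1) by (intro inj_onD[OF inj]) auto
    then have "x = \<one>"
      using assms(3) x(1) y(2) unfolding iterable_def torsion_free_group_def by blast
    then show "y = \<one>\<^bsub>H\<^esub>"
      using x(2) by simp
  qed
  moreover have "(derived H ^^ d) (carrier H) \<noteq> {\<one>\<^bsub>H\<^esub>}"
  proof
    assume "(derived H ^^ d) (carrier H) = {\<one>\<^bsub>H\<^esub>}"
    then have "h ` (derived G ^^ d) (carrier G) = h ` {\<one>}"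
      using exp_of_derived_img[of "carrier G" d] surj by simp
    moreover have "(derived G ^^ d) (carrier G) \<subseteq> carrier G"
      by (rule G.exp_of_derived_in_carrier) simp
    ultimately have "(derived G ^^ d) (carrier G) = {\<one>}"
      using inj_on_image_eq_iff[OF inj, of _ "{\<one>}"] by simp
    then show False using assms(3) by (simp add: iterable_def)
  qed
  ultimately show ?thesis
    using assms(3) surj_finitely_generated[OF surj] surj_B_hat[OF surj] surj_hom_imp_solvable[OF surj]
    unfolding iterable_def by blast
qed

text \<open>The obstruction is what gets transferred: a finite generating set of the image of S
  would pull back to one of S.\<close>

lemma (in group_hom) iso_not_polycyclic:
  assumes surj: "h ` carrier G = carrier H" and inj: "inj_on h (carrier G)"
    and S: "subgroup S G" "\<not> finitely_generated_subset G S"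
  shows "\<not> polycyclic_group H"
proof
  assume "polycyclic_group H"
  then have "finitely_generated_subset H (h ` S)"
    using polycyclic_imp_finitely_generated_subset subgroup_img_is_subgroup[OF S(1)] by blast
  then obtain F where F: "finite F" "F \<subseteq> h ` S" "generate H F = h ` S"
    unfolding finitely_generated_subset_def by blast
  obtain E where E: "E \<subseteq> S" "finite E" "F = h ` E"
    using finite_subset_image[OF F(1,2)] by blast
  have sub: "S \<subseteq> carrier G" by (rule subgroup.subset[OF S(1)])
  have "h ` generate G E = h ` S"
    using generate_img[of E] E sub F(3) by auto
  moreover have "generate G E \<subseteq> carrier G"
    using E sub by (intro G.generate_incl) auto
  ultimately have "generate G E = S"
    using inj_on_image_eq_iff[OF inj] sub by blast
  then show False
    using S(2) E unfolding finitely_generated_subset_def by blast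
qed

lemma infinite_carrier_torsion_free:
  assumes "torsion_free_group G" "carrier G \<noteq> {\<one>\<^bsub>G\<^esub>}"
  shows "infinite (carrier G)"
proof
  assume fin: "finite (carrier G)"
  interpret group G using assms(1) by (simp add: torsion_free_group_def)
  have "order G > 0" using fin by (simp add: order_gt_0_iff_finite)
  then have "x = \<one>\<^bsub>G\<^esub>" if "x \<in> carrier G" for x
    using assms(1) pow_order_eq_1[OF that] that unfolding torsion_free_group_def by blast
  then show False using assms(2) one_closed by blast
qed

text \<open>The element type of the wreath product grows with every step, while the induction needs
  one fixed type. Countable groups can be renamed to groups on \<open>nat\<close>.\<close>

lemma (in group) countable_imp_iso_nat_monoid:
  assumes "countable (carrier G)"
  obtains G' :: "nat monoid" and f
  where "group_hom G G' f" "f ` carrier G = carrier G'" "inj_on f (carrier G)"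
proof
  let ?f = "to_nat_on (carrier G)"
  show inj: "inj_on ?f (carrier G)"
    by (rule inj_on_to_nat_on[OF assms])
  show "?f ` carrier G = carrier (image_group ?f G)"
    by (simp add: image_group_carrier)
  show "group_hom G (image_group ?f G) ?f"
    using inj_imp_image_group_iso[OF inj] inj_imp_image_group_is_group[OF inj]
    by (auto intro!: group_hom.intro group_hom_axioms.intro is_group simp: iso_def)
qed

section \<open>The step and the induction\<close>

lemma (in signed_pair) iterable_twisted_wreath:
  assumes "iterable d K" "finitely_generated_group W" "torsion_free_group W" "solvable W"
    "W \<in> B_hat n" "n > 0"
  shows "iterable (Suc d) (twisted_wreath K W \<chi>)"
proof -
  from assms(1) obtain m where m: "m > 0" "K \<in> B_hat m"
    unfolding iterable_def by blast
  have "twisted_wreath K W \<chi> \<in> B_hat (n * m * 2)"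
    by (rule B_hat_twisted_wreath[OF m(2) assms(5)])
  moreover have "n * m * 2 > 0" using m(1) assms(6) by simp
  ultimately have "\<exists>n>0. twisted_wreath K W \<chi> \<in> B_hat n" by blast
  then show ?thesis
    using assms finitely_generated_twisted_wreath torsion_free_twisted_wreath solvable_twisted_wreath
      derived_twisted_wreath_nontrivial
    unfolding iterable_def by blast
qed

lemma iterable_imp_infinite:
  assumes "iterable d G"
  shows "infinite (carrier G)"
proof -
  interpret group G using assms by (simp add: iterable_def torsion_free_group_def)
  have sub: "subgroup ((derived G ^^ d) (carrier G)) G"
    by (rule exp_of_derived_is_subgroup[OF subgroup_self])
  have "carrier G \<noteq> {\<one>\<^bsub>G\<^esub>}"
    using assms subgroup.subset[OF sub] subgroup.one_closed[OF sub] unfolding iterable_def by blast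
  then show ?thesis
    using assms infinite_carrier_torsion_free unfolding iterable_def by blast
qed

lemma iterable_step:
  fixes K :: "('a::countable, 'b) monoid_scheme"
  assumes K: "iterable d K"
  shows "\<exists>G :: nat monoid. iterable (Suc d) G \<and> \<not> polycyclic_group G"
proof -
  let ?\<chi> = "\<lambda>(u::int, v::int, w::int). parity_sign u"
  let ?G = "twisted_wreath K hantzsche_wendt ?\<chi>"
  have "group K"
    using K by (simp add: iterable_def torsion_free_group_def)
  then interpret signed_pair K hantzsche_wendt ?\<chi> "(1, 0, 1)"
    by (rule signed_pair_hantzsche_wendt)
  have iter: "iterable (Suc d) ?G"
    using iterable_twisted_wreath[OF K finitely_generated_hantzsche_wendt torsion_free_hantzsche_wendt
        solvable_hantzsche_wendt B_hat_hantzsche_wendt] by simp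
  obtain S where S: "subgroup S ?G" "\<not> finitely_generated_subset ?G S"
    using twisted_wreath_infinitely_generated_subgroup[OF iterable_imp_infinite[OF K]] by blast
  have "group ?G"
    using iter by (simp add: iterable_def torsion_free_group_def)
  moreover have "countable (carrier ?G)"
    by (simp add: twisted_wreath_def semidirect_def countable_fin_supp_funs)
  ultimately obtain G' :: "nat monoid" and f
    where f: "group_hom ?G G' f" "f ` carrier ?G = carrier G'" "inj_on f (carrier ?G)"
    by (rule group.countable_imp_iso_nat_monoid)
  show ?thesis
    using group_hom.iterable_iso[OF f iter] group_hom.iso_not_polycyclic[OF f S] by blast
qed

lemma iterable_hantzsche_wendt: "iterable 0 hantzsche_wendt"
proof -
  have "(1, 0, 1) \<in> carrier hantzsche_wendt" "(1, 0, 1) \<noteq> \<one>\<^bsub>hantzsche_wendt\<^esub>" by simp_all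
  then have "carrier hantzsche_wendt \<noteq> {\<one>\<^bsub>hantzsche_wendt\<^esub>}" by blast
  moreover have "\<exists>n>0. hantzsche_wendt \<in> B_hat n"
    using B_hat_hantzsche_wendt by (intro exI[of _ 8]) simp
  ultimately show ?thesis
    unfolding iterable_def
    using finitely_generated_hantzsche_wendt torsion_free_hantzsche_wendt solvable_hantzsche_wendt
    by simp
qed

text \<open>The index starts at 1: the first step leads from integer triples to a non-polycyclic
  group on \<open>nat\<close>, and d counts the steps after it.\<close>

lemma exists_iterable_not_polycyclic:
  "\<exists>G :: nat monoid. iterable (Suc d) G \<and> \<not> polycyclic_group G"
proof (induction d)
  case 0
  show ?case by (rule iterable_step[OF iterable_hantzsche_wendt])
next
  case (Suc d)
  then show ?case using iterable_step by blast
qed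

text \<open>Once trivial, the derived series stays trivial, so a nontrivial d-th term lies strictly
  before the derived length.\<close>

lemma iterable_imp_derived_length:
  assumes "iterable d G"
  shows "d < derived_length G"
proof (rule ccontr)
  interpret group G using assms by (simp add: iterable_def torsion_free_group_def)
  assume "\<not> d < derived_length G"
  then obtain j where j: "d = j + derived_length G" by (metis add.commute le_Suc_ex not_less)
  \<comment> \<open>Solvability guarantees that the \<open>LEAST\<close> in
    \<open>derived_length\<close> is attained.\<close>
  have "\<exists>n. (derived G ^^ n) (carrier G) = {\<one>\<^bsub>G\<^esub>}"
    using assms solvable_iff_trivial_derived_seq unfolding iterable_def by blast
  then have triv: "(derived G ^^ derived_length G) (carrier G) = {\<one>\<^bsub>G\<^esub>}"
    unfolding derived_length_def by (rule LeastI_ex)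
  have "derived G {\<one>\<^bsub>G\<^esub>} = {\<one>\<^bsub>G\<^esub>}"
    using derived_incl[OF subset_refl triv_subgroup] subgroup.one_closed[OF derived_is_subgroup]
    by fastforce
  then have "(derived G ^^ j) {\<one>\<^bsub>G\<^esub>} = {\<one>\<^bsub>G\<^esub>}"
    by (induction j) simp_all
  then have "(derived G ^^ d) (carrier G) = {\<one>\<^bsub>G\<^esub>}"
    by (simp add: j funpow_add triv)
  then show False using assms by (simp add: iterable_def)
qed

theorem mainTheorem9:
  shows "(\<exists>G :: nat monoid. finitely_generated_group G \<and> torsion_free_group G \<and>
            (\<exists>n>0. G \<in> B_hat n) \<and> \<not> polycyclic_group G) \<and>
         (\<forall>d::nat. d > 0 \<longrightarrow>
            (\<exists>G :: nat monoid. finitely_generated_group G \<and> torsion_free_group G \<and>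
               solvable G \<and> derived_length G \<ge> d \<and> \<not> polycyclic_group G \<and>
               (\<exists>n>0. G \<in> B_hat n)))"
proof -
  have "\<exists>G :: nat monoid. finitely_generated_group G \<and> torsion_free_group G \<and>
               solvable G \<and> derived_length G \<ge> d \<and> \<not> polycyclic_group G \<and>
               (\<exists>n>0. G \<in> B_hat n)" for d
  proof -
    obtain G :: "nat monoid" where G: "iterable (Suc d) G" "\<not> polycyclic_group G"
      using exists_iterable_not_polycyclic by blast
    then have "derived_length G \<ge> d"
      using iterable_imp_derived_length[OF G(1)] by simp
    then show ?thesis
      using G unfolding iterable_def by blast
  qed
  \<comment> \<open>The first conjunct follows from the group for any d by forgetting solvability
    and derived length.\<close>
  then show ?thesis by blast
qed

end
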